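(* Let $\epsilon\in(0,1)$, and consider instances of Fair Max-Min diversification with $m=2$ groups, $n$ points, parameters $k_1,k_2$, $k=k_1+k_2$, optimal diversity $\ell^*$, whose points arrive one by one in a stream, where a lower bound on the minimum and an upper bound on the maximum pairwise distance are given with ratio $\mathrm{poly}(n)$. There is a one-pass streaming algorithm that returns a $4(1+\epsilon)$-approximation for the Fair Max-Min diversification problem, i.e. a set $\mathcal{S}\subseteq\mathcal{X}$ with $|\mathcal{S}\cap\mathcal{X}_i|=k_i$ for $i\in\{1,2\}$ and $\mathrm{div}(\mathcal{S})\ge\ell^*/(4(1+\epsilon))$, using $O(k\epsilon^{-1}\log n)$ space.
   Context: Fair Max-Min diversification: the input is a finite metric space $(\mathcal{X},d)$ with $|\mathcal{X}|=n$, where $\mathcal{X}=\bigcup_{i=1}^m\mathcal{X}_i$ is partitioned into $m$ disjoint groups, and non-negative integers $k_1,\dots,k_m$ with $k_i\le|\mathcal{X}_i|$. For $\mathcal{S}\subseteq\mathcal{X}$ let $\mathrm{div}(\mathcal{S})=\min_{u,v\in\mathcal{S},u\ne v}d(u,v)$ (the minimum over the empty set is $+\infty$). The optimal diversity is $\ell^*=\max\{\mathrm{div}(\mathcal{S}):\mathcal{S}\subseteq\mathcal{X},\ |\mathcal{S}\cap\mathcal{X}_i|=k_i\ \forall i\in[m]\}$. Streaming: points are revealed one at a time (with their group), in one pass; space is measured in the number of stored points, and distances between stored points (and the current point) can be evaluated. *)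

theory Defs
  imports "HOL-Analysis.Analysis" "HOL-Computational_Algebra.Polynomial"
begin

definition fair_instance ::
  "nat \<Rightarrow> 'a set \<Rightarrow> ('a \<Rightarrow> 'a \<Rightarrow> real) \<Rightarrow> (nat \<Rightarrow> 'a set) \<Rightarrow> (nat \<Rightarrow> nat) \<Rightarrow> bool" where
  "fair_instance m X d G k \<longleftrightarrow>
     finite X \<and> Metric_space X d \<and>
     X = (\<Union>i\<in>{1..m}. G i) \<and> disjoint_family_on G {1..m} \<and>
     (\<forall>i\<in>{1..m}. k i \<le> card (G i))"

(* The infimum is a minimum on finite sets; it is \<infinity> when S has at most one element. *)
definition diversity :: "('a \<Rightarrow> 'a \<Rightarrow> real) \<Rightarrow> 'a set \<Rightarrow> ereal" where
  "diversity d S = (INF (u, v)\<in>{(u, v). u \<in> S \<and> v \<in> S \<and> u \<noteq> v}. ereal (d u v))"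

definition fair_sets :: "nat \<Rightarrow> 'a set \<Rightarrow> (nat \<Rightarrow> 'a set) \<Rightarrow> (nat \<Rightarrow> nat) \<Rightarrow> 'a set set" where
  "fair_sets m X G k = {S. S \<subseteq> X \<and> (\<forall>i\<in>{1..m}. card (S \<inter> G i) = k i)}"

definition opt_diversity ::
  "nat \<Rightarrow> 'a set \<Rightarrow> ('a \<Rightarrow> 'a \<Rightarrow> real) \<Rightarrow> (nat \<Rightarrow> 'a set) \<Rightarrow> (nat \<Rightarrow> nat) \<Rightarrow> ereal" where
  "opt_diversity m X d G k = Max (diversity d ` fair_sets m X G k)"

(* A stream lists every point exactly once, paired with the index of its group. *)
definition stream_of :: "nat \<Rightarrow> (nat \<Rightarrow> 'a set) \<Rightarrow> ('a \<times> nat) list \<Rightarrow> bool" where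
  "stream_of m G \<sigma> \<longleftrightarrow> distinct \<sigma> \<and> set \<sigma> = {(x, i). i \<in> {1..m} \<and> x \<in> G i}"

(* What an algorithm can learn about a list of points: their groups and their distance
   matrix, but nothing about the identity of the points. *)
type_synonym view = "nat list \<times> real list list"

definition view :: "('a \<Rightarrow> 'a \<Rightarrow> real) \<Rightarrow> ('a \<times> nat) list \<Rightarrow> view" where
  "view d ms = (map snd ms, map (\<lambda>(x, _). map (\<lambda>(y, _). d x y) ms) ms)"

(* One-pass algorithms that access points only through positions in memory.  The memory is
   a list of stored points with their groups, and nothing else is carried from one arrival
   to the next.  When a point arrives it is appended to the memory, and retain selects,
   from the view of that list, the positions that are kept.  After the last arrival,
   answer selects the positions of the points to be returned. *)
record stream_alg =
  retain :: "view \<Rightarrow> nat set"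
  answer :: "view \<Rightarrow> nat set"

definition stream_step ::
  "stream_alg \<Rightarrow> ('a \<Rightarrow> 'a \<Rightarrow> real) \<Rightarrow> ('a \<times> nat) list \<Rightarrow> 'a \<times> nat \<Rightarrow> ('a \<times> nat) list" where
  "stream_step A d ms x = nths (ms @ [x]) (retain A (view d (ms @ [x])))"

definition stream_memory ::
  "stream_alg \<Rightarrow> ('a \<Rightarrow> 'a \<Rightarrow> real) \<Rightarrow> ('a \<times> nat) list \<Rightarrow> ('a \<times> nat) list" where
  "stream_memory A d \<sigma> = foldl (stream_step A d) [] \<sigma>"

definition stream_result ::
  "stream_alg \<Rightarrow> ('a \<Rightarrow> 'a \<Rightarrow> real) \<Rightarrow> ('a \<times> nat) list \<Rightarrow> 'a set" where
  "stream_result A d \<sigma> =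
     (let ms = stream_memory A d \<sigma> in fst ` set (nths ms (answer A (view d ms))))"

(* The number of stored points (in addition to the arriving one) never exceeds B. *)
definition stream_space_le ::
  "stream_alg \<Rightarrow> ('a \<Rightarrow> 'a \<Rightarrow> real) \<Rightarrow> ('a \<times> nat) list \<Rightarrow> real \<Rightarrow> bool" where
  "stream_space_le A d \<sigma> B \<longleftrightarrow>
     (\<forall>t\<le>length \<sigma>. real (length (stream_memory A d (take t \<sigma>))) \<le> B)"

end

theory Submission
  imports Defs
begin

text \<open>
  For each guess \<open>\<mu>\<close> on a geometric grid with ratio \<open>1 + \<epsilon>\<close>, keep greedy \<open>\<mu>\<close>-separated sets: one of
  capacity \<open>k\<^sub>1 + k\<^sub>2\<close> that ignores the groups, and one of capacity \<open>k\<^sub>i\<close> inside each group. If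
  \<open>2\<mu> \<le> \<ell>*\<close> then all of them are filled, because a ball of radius less than \<open>\<mu>\<close> contains at
  most one point of an optimal set. In the group-blind set the deficient group is completed by
  points of its own greedy set that are at distance at least \<open>\<mu>/2\<close> from the points of that group
  already present, and each added point evicts at most one point of the other group from its
  \<open>\<mu>/2\<close>-neighbourhood. This leaves a fair \<open>\<mu>/2\<close>-separated set. One of the guesses satisfies
  \<open>\<ell>*/(1 + \<epsilon>) \<le> 2\<mu> \<le> \<ell>*\<close>, and the answer is a best fair subset of the memory.
\<close>

section \<open>Greedy separated sets with a capacity\<close>

definition greedy :: "('b list \<Rightarrow> 'b \<Rightarrow> bool) \<Rightarrow> 'b list \<Rightarrow> 'b list" where
  "greedy P xs = foldl (\<lambda>S x. if P S x then S @ [x] else S) [] xs"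

lemma greedy_Nil [simp]: "greedy P [] = []"
  by (simp add: greedy_def)

lemma greedy_snoc:
  "greedy P (xs @ [x]) = (if P (greedy P xs) x then greedy P xs @ [x] else greedy P xs)"
  by (simp add: greedy_def)

lemma set_greedy_subset: "set (greedy P xs) \<subseteq> set xs"
  by (induction xs rule: rev_induct) (auto simp: greedy_snoc)

text \<open>This is why an algorithm without working memory can recover all greedy sets: running the
  greedy procedure on the stored points alone reproduces its result on the whole prefix.\<close>

lemma greedy_filter:
  assumes "set (greedy P xs) \<subseteq> K"
  shows "greedy P (filter (\<lambda>x. x \<in> K) xs) = greedy P xs"
  using assms by (induction xs rule: rev_induct) (auto simp: greedy_snoc split: if_splits)

text \<open>Transfers a greedy run on memory positions to the same run on stored points. The
  predicates need to agree only on entries of \<open>xs\<close>, since a distance matrix is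
  meaningful only at valid positions.\<close>

lemma map_greedy:
  assumes "\<And>S x. set S \<subseteq> set xs \<Longrightarrow> x \<in> set xs \<Longrightarrow> P S x \<longleftrightarrow> P' (map f S) (f x)"
  shows "map f (greedy P xs) = greedy P' (map f xs)"
  using assms
proof (induction xs rule: rev_induct)
  case (snoc x xs)
  have "map f (greedy P xs) = greedy P' (map f xs)"
    by (rule snoc.IH, rule snoc.prems) auto
  moreover have "P (greedy P xs) x \<longleftrightarrow> P' (map f (greedy P xs)) (f x)"
    using set_greedy_subset[of P xs] by (intro snoc.prems) auto
  ultimately show ?case
    by (simp add: greedy_snoc)
qed simp

definition admits ::
  "(nat \<Rightarrow> nat) \<Rightarrow> real \<Rightarrow> nat set \<Rightarrow> ('b \<Rightarrow> nat) \<Rightarrow> ('b \<Rightarrow> 'b \<Rightarrow> real) \<Rightarrow> 'b list \<Rightarrow> 'b \<Rightarrow> bool" where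
  "admits k \<mu> Q g D S x \<longleftrightarrow> g x \<in> Q \<and> length S < sum k Q \<and> (\<forall>y\<in>set S. \<mu> \<le> D y x)"

lemma length_greedy_le: "length (greedy (admits k \<mu> Q g D) xs) \<le> sum k Q"
  by (induction xs rule: rev_induct) (auto simp: greedy_snoc admits_def)

lemma greedy_in_groups: "x \<in> set (greedy (admits k \<mu> Q g D) xs) \<Longrightarrow> g x \<in> Q"
  by (induction xs rule: rev_induct) (auto simp: greedy_snoc admits_def split: if_splits)

lemma distinct_greedy: "distinct xs \<Longrightarrow> distinct (greedy P xs)"
proof (induction xs rule: rev_induct)
  case (snoc x xs)
  then show ?case
    using set_greedy_subset[of P xs] by (auto simp: greedy_snoc)
qed simp

text \<open>Symmetry enters because \<open>admits\<close> compares an arrival with the stored points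
  in one order only.\<close>

lemma greedy_separated:
  assumes "\<And>x y. D x y = D y x"
  shows "pairwise (\<lambda>x y. \<mu> \<le> D x y) (set (greedy (admits k \<mu> Q g D) xs))"
proof (induction xs rule: rev_induct)
  case (snoc x xs)
  then show ?case
    using assms by (auto simp: greedy_snoc admits_def pairwise_insert)
qed simp

text \<open>Below capacity, a point of an allowed group is rejected only for being closer than
  \<open>\<mu>\<close> to a stored point; an accepted point is its own witness because
  \<open>D x x = 0\<close>. Greedy sets only grow, so the witness survives to the end.\<close>

lemma greedy_covers:
  assumes "D x x = 0" "\<mu> > 0"
    and "length (greedy (admits k \<mu> Q g D) xs) < sum k Q" "x \<in> set xs" "g x \<in> Q"
  shows "\<exists>y\<in>set (greedy (admits k \<mu> Q g D) xs). D y x < \<mu>"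
  using assms(3-)
proof (induction xs rule: rev_induct)
  case (snoc z zs)
  let ?g = "greedy (admits k \<mu> Q g D) zs"
  have l: "length ?g < sum k Q"
    using snoc.prems(1) by (auto simp: greedy_snoc split: if_splits)
  show ?case
  proof (cases "x \<in> set zs")
    case True
    then show ?thesis
      using snoc.IH[OF l True snoc.prems(3)] by (auto simp: greedy_snoc)
  next
    case False
    then show ?thesis
      using snoc.prems l assms(1,2) by (auto simp: greedy_snoc admits_def not_le)
  qed
qed simp

section \<open>Packing and exchange in a metric space\<close>

context Metric_space
begin

text \<open>Assign to each such point of \<open>S\<close> a nearby point of \<open>Y\<close>. Two
  points sharing an image would be at distance below \<open>r\<close> by the triangle inequality, so
  the assignment is injective.\<close>

lemma card_near_le:
  assumes S: "pairwise (\<lambda>x y. r \<le> d x y) S" "S \<subseteq> M" and Y: "finite Y" "Y \<subseteq> M"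
  shows "finite {x\<in>S. \<exists>y\<in>Y. d y x < r / 2} \<and> card {x\<in>S. \<exists>y\<in>Y. d y x < r / 2} \<le> card Y"
proof -
  let ?U = "{x\<in>S. \<exists>y\<in>Y. d y x < r / 2}"
  define f where "f x = (SOME y. y \<in> Y \<and> d y x < r / 2)" for x
  have f: "f x \<in> Y \<and> d (f x) x < r / 2" if "x \<in> ?U" for x
  proof -
    from that have "\<exists>y. y \<in> Y \<and> d y x < r / 2" by blast
    then show ?thesis unfolding f_def by (rule someI_ex)
  qed
  have inj: "inj_on f ?U"
  proof (rule inj_onI, rule ccontr)
    fix x x' assume x: "x \<in> ?U" "x' \<in> ?U" "f x = f x'" "x \<noteq> x'"
    then have "d x x' \<le> d x (f x) + d (f x) x'"
      using f[of x] S(2) Y(2) by (intro triangle) auto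
    moreover have "d x (f x) < r / 2" "d (f x) x' < r / 2"
      using f[of x] f[of x'] x commute[of x "f x"] by auto
    moreover have "r \<le> d x x'"
      using x S(1) by (auto simp: pairwise_def)
    ultimately show False by simp
  qed
  have im: "f ` ?U \<subseteq> Y" by (rule image_subsetI) (rule f[THEN conjunct1])
  show ?thesis
    using inj_on_finite[OF inj im Y(1)] card_inj_on_le[OF inj im Y(1)] by (rule conjI)
qed

text \<open>Points of \<open>A\<close> spoil at most \<open>card A\<close> points of
  \<open>T1\<close>, so \<open>k1 - card A\<close> usable ones remain to form \<open>N\<close>.
  These evict at most \<open>card N\<close> points of \<open>B\<close>, and
  \<open>card B - card N = k2\<close>. The loss from \<open>r\<close> to \<open>r / 2\<close> occurs
  only between \<open>N\<close> and the old points.\<close>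

lemma exchange_into_balance:
  assumes "0 < r" and T: "A \<union> B \<subseteq> M" "finite A" "finite B" "pairwise (\<lambda>x y. r \<le> d x y) (A \<union> B)"
    and T1: "T1 \<subseteq> M" "finite T1" "pairwise (\<lambda>x y. r \<le> d x y) T1" "card T1 = k1"
    and k: "card A \<le> k1" "card A + card B = k1 + k2"
  obtains A' B' where "A' \<subseteq> A \<union> T1" "B' \<subseteq> B" "card A' = k1" "card B' = k2"
    "pairwise (\<lambda>x y. r / 2 \<le> d x y) (A' \<union> B')"
proof -
  define U where "U = {x\<in>T1. \<exists>y\<in>A. d y x < r / 2}"
  have "finite U \<and> card U \<le> card A"
    unfolding U_def using T T1 by (intro card_near_le) auto
  then have "k1 - card A \<le> card (T1 - U)"
    using T1(4) by (auto simp: U_def card_Diff_subset)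
  then obtain N where N: "N \<subseteq> T1 - U" "card N = k1 - card A" "finite N"
    by (meson obtain_subset_with_card_n)
  define V where "V = {b\<in>B. \<exists>y\<in>N. d y b < r / 2}"
  have "finite V \<and> card V \<le> card N"
    unfolding V_def using T N T1 by (intro card_near_le) (auto intro: pairwise_subset)
  then have "k2 \<le> card (B - V)"
    using N(2) k by (auto simp: V_def card_Diff_subset)
  then obtain B' where B': "B' \<subseteq> B - V" "card B' = k2"
    by (meson obtain_subset_with_card_n)
  have far: "r / 2 \<le> d x y" if "x \<in> A" "y \<in> N" for x y
    using that N(1) by (force simp: U_def not_less)
  have far': "r / 2 \<le> d x y" if "x \<in> N" "y \<in> B'" for x y
    using that B'(1) by (force simp: V_def not_less)
  have "A \<inter> N = {}"
  proof (rule ccontr)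
    assume "A \<inter> N \<noteq> {}"
    then obtain x where x: "x \<in> A" "x \<in> N" by blast
    then have "d x x = 0" using T by auto
    then show False using far[OF x] \<open>0 < r\<close> by simp
  qed
  show ?thesis
  proof
    show "A \<union> N \<subseteq> A \<union> T1" "B' \<subseteq> B" "card B' = k2"
      using N B' by auto
    show "card (A \<union> N) = k1"
      using \<open>A \<inter> N = {}\<close> N k T by (simp add: card_Un_disjoint)
    have half: "r \<le> d x y \<Longrightarrow> r / 2 \<le> d x y" for x y
      using \<open>0 < r\<close> by simp
    show "pairwise (\<lambda>x y. r / 2 \<le> d x y) ((A \<union> N) \<union> B')"
    proof (rule pairwiseI)
      fix x y assume xy: "x \<in> (A \<union> N) \<union> B'" "y \<in> (A \<union> N) \<union> B'" "x \<noteq> y"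
      have AB: "r / 2 \<le> d x y" if "x \<in> A \<union> B" "y \<in> A \<union> B"
        using that T(4) xy(3) by (intro half) (auto simp: pairwise_def)
      have NN: "r / 2 \<le> d x y" if "x \<in> N" "y \<in> N"
        using that T1(3) N(1) xy(3) by (intro half) (auto simp: pairwise_def)
      show "r / 2 \<le> d x y"
        using xy AB NN far[of x y] far[of y x] far'[of x y] far'[of y x] commute[of x y] B'(1)
        by auto
    qed
  qed
qed

end

section \<open>The memory contents and the fair set they contain\<close>

text \<open>Ranging over \<open>Pow {1, 2}\<close> treats the group-blind set and the two group sets uniformly; the
  empty set has capacity \<open>0\<close> and contributes nothing.\<close>

definition kept ::
  "(nat \<Rightarrow> nat) \<Rightarrow> real set \<Rightarrow> ('b \<Rightarrow> nat) \<Rightarrow> ('b \<Rightarrow> 'b \<Rightarrow> real) \<Rightarrow> 'b list \<Rightarrow> 'b set" where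
  "kept k L g D xs = (\<Union>\<mu>\<in>L. \<Union>Q\<in>Pow {1, 2}. set (greedy (admits k \<mu> Q g D) xs))"

lemma kept_subset: "kept k L g D xs \<subseteq> set xs"
  using set_greedy_subset by (fastforce simp: kept_def)

lemma kept_snoc: "kept k L g D (xs @ [x]) \<subseteq> insert x (kept k L g D xs)"
  by (auto simp: kept_def greedy_snoc split: if_splits)

lemma kept_filter:
  assumes "kept k L g D xs \<subseteq> K"
  shows "kept k L g D (filter (\<lambda>x. x \<in> K) xs) = kept k L g D xs"
proof -
  have "greedy (admits k \<mu> Q g D) (filter (\<lambda>x. x \<in> K) xs) = greedy (admits k \<mu> Q g D) xs"
    if "\<mu> \<in> L" "Q \<in> Pow {1, 2}" for \<mu> Q
    using assms that by (intro greedy_filter) (auto simp: kept_def)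
  then show ?thesis
    unfolding kept_def by (intro SUP_cong refl) metis
qed

lemma image_kept:
  assumes "\<And>x. x \<in> set xs \<Longrightarrow> g x = g' (f x)"
    and "\<And>x y. x \<in> set xs \<Longrightarrow> y \<in> set xs \<Longrightarrow> D x y = D' (f x) (f y)"
  shows "f ` kept k L g D xs = kept k L g' D' (map f xs)"
proof -
  have "map f (greedy (admits k \<mu> Q g D) xs) = greedy (admits k \<mu> Q g' D') (map f xs)" for \<mu> Q
    using assms by (intro map_greedy) (auto simp: admits_def subset_iff)
  then have "f ` set (greedy (admits k \<mu> Q g D) xs) = set (greedy (admits k \<mu> Q g' D') (map f xs))" for \<mu> Q
    by (metis set_map)
  then show ?thesis
    by (simp add: kept_def image_UN)
qed

lemma card_kept:
  assumes "finite L"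
  shows "card (kept k L g D xs) \<le> 2 * card L * (k 1 + k 2)"
proof -
  have "card (kept k L g D xs) \<le> (\<Sum>\<mu>\<in>L. \<Sum>Q\<in>Pow {1, 2}. sum k Q)"
    unfolding kept_def
    by (intro order.trans[OF card_UN_le] sum_mono assms order.trans[OF card_length length_greedy_le])
      simp
  \<comment> \<open>Each group belongs to exactly two of the four subsets of
    \<open>{1, 2}\<close>.\<close>
  also have "(\<Sum>Q\<in>Pow {1, 2::nat}. sum k Q) = 2 * (k 1 + k 2)"
    by (simp add: Pow_insert doubleton_eq_iff insert_eq_iff)
  finally show ?thesis
    by (simp add: algebra_simps)
qed


text \<open>This is the approximation argument for a single guess. Packing \<open>Opt\<close>
  against a greedy set shows that the set is full; then \<open>exchange_into_balance\<close> is
  applied to whichever group does not exceed its quota in the group-blind set.\<close>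

lemma (in Metric_space) kept_contains_fair:
  assumes xs: "set xs \<subseteq> M" "distinct xs" and g: "g ` set xs \<subseteq> {1, 2}"
    and L: "\<mu> \<in> L" "0 < \<mu>"
    and Opt: "Opt \<subseteq> set xs" "pairwise (\<lambda>x y. 2 * \<mu> \<le> d x y) Opt"
      "\<forall>i\<in>{1..2}. card {x\<in>Opt. g x = i} = k i"
  obtains T where "T \<subseteq> kept k L g d xs" "pairwise (\<lambda>x y. \<mu> / 2 \<le> d x y) T"
    "\<forall>i\<in>{1..2}. card {x\<in>T. g x = i} = k i"
proof -
  define Gr where "Gr Q = set (greedy (admits k \<mu> Q g d) xs)" for Q
  have Gr_sub: "Gr Q \<subseteq> set xs" for Q
    unfolding Gr_def by (rule set_greedy_subset)
  have finOpt: "finite Opt"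
    using Opt(1) finite_subset by blast
  have card_Gr: "card (Gr Q) = sum k Q" if Q: "Q \<subseteq> {1, 2}" for Q
  proof (rule ccontr)
    have len: "card (Gr Q) = length (greedy (admits k \<mu> Q g d) xs)"
      unfolding Gr_def by (intro distinct_card distinct_greedy xs)
    assume "card (Gr Q) \<noteq> sum k Q"
    then have less: "length (greedy (admits k \<mu> Q g d) xs) < sum k Q"
      using length_greedy_le[of k \<mu> Q g d xs] len by linarith
    define P where "P = {x\<in>Opt. g x \<in> Q}"
    have "P = (\<Union>i\<in>Q. {x\<in>Opt. g x = i})"
      by (auto simp: P_def)
    then have "card P = (\<Sum>i\<in>Q. card {x\<in>Opt. g x = i})"
      using finOpt finite_subset[OF Q] by (simp add: card_UN_disjoint disjoint_iff)
    also have "\<dots> = sum k Q"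
      using Opt(3) Q by (intro sum.cong) auto
    finally have "card P = sum k Q" .
    \<comment> \<open>As \<open>Opt\<close> is \<open>2 * \<mu>\<close>-separated, the radius in
      \<open>card_near_le\<close> is exactly the \<open>\<mu>\<close> that
      \<open>greedy_covers\<close> supplies. Hence
      \<open>sum k Q = card P \<le> card (Gr Q)\<close>, against the assumed deficiency.\<close>
    moreover have "P = {x\<in>P. \<exists>y\<in>Gr Q. d y x < (2 * \<mu>) / 2}"
    proof -
      have "\<exists>y\<in>Gr Q. d y x < \<mu>" if "x \<in> P" for x
        unfolding Gr_def using that Opt(1) xs(1) L(2) less
        by (intro greedy_covers) (auto simp: P_def)
      then show ?thesis by auto
    qed
    moreover have "card {x\<in>P. \<exists>y\<in>Gr Q. d y x < (2 * \<mu>) / 2} \<le> card (Gr Q)"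
      using Opt xs Gr_sub[of Q]
      by (intro card_near_le[THEN conjunct2])
        (auto simp: P_def Gr_def intro: pairwise_subset)
    ultimately show False
      using len less by simp
  qed
  define S where "S i = {x\<in>Gr {1, 2}. g x = i}" for i
  have finS: "finite (S i)" for i
    by (simp add: S_def Gr_def)
  have S_union: "Gr {1, 2} = S 1 \<union> S 2"
    using g Gr_sub[of "{1, 2}"] by (auto simp: S_def)
  have "card (S 1) + card (S 2) = card (Gr {1, 2})"
    unfolding S_union by (intro card_Un_disjoint[symmetric] finS) (auto simp: S_def)
  then have card_S: "card (S 1) + card (S 2) = k 1 + k 2"
    using card_Gr[of "{1, 2}"] by simp
  have Gr_kept: "Gr Q \<subseteq> kept k L g d xs" if "Q \<subseteq> {1, 2}" for Q
    using that L(1) by (auto simp: Gr_def kept_def)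
  have sep: "pairwise (\<lambda>x y. \<mu> \<le> d x y) (Gr Q)" for Q
    unfolding Gr_def by (rule greedy_separated) (rule commute)
  note goal = that
  \<comment> \<open>Stated for an arbitrary ordering of the two groups, so that either may be the
    deficient one. By \<open>card_S\<close>, at least one of them is within its quota.\<close>
  have *: thesis if ij: "{i, j} = {1, 2}" "i \<noteq> j" and le: "card (S i) \<le> k i" for i j
  proof -
    have SS: "S i \<union> S j = Gr {1, 2}"
      using S_union ij(1) by (auto simp: doubleton_eq_iff)
    have i: "{i} \<subseteq> {1, 2}" using ij(1) by auto
    have k: "card (S i) + card (S j) = k i + k j"
      using card_S ij(1) by (auto simp: doubleton_eq_iff)
    obtain A B where AB: "A \<subseteq> S i \<union> Gr {i}" "B \<subseteq> S j" "card A = k i" "card B = k j"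
      "pairwise (\<lambda>x y. \<mu> / 2 \<le> d x y) (A \<union> B)"
    proof (rule exchange_into_balance[OF L(2) _ finS finS _ _ _ sep _ le k])
      show "S i \<union> S j \<subseteq> M" "pairwise (\<lambda>x y. \<mu> \<le> d x y) (S i \<union> S j)"
        using SS Gr_sub xs sep by auto
      show "Gr {i} \<subseteq> M" "finite (Gr {i})" "card (Gr {i}) = k i"
        using Gr_sub xs card_Gr[OF i] by (auto simp: Gr_def)
    qed
    have gA: "\<forall>x\<in>A. g x = i"
      using AB(1) greedy_in_groups[of _ k \<mu> "{i}" g d xs] by (auto simp: S_def Gr_def)
    have gB: "\<forall>x\<in>B. g x = j"
      using AB(2) by (auto simp: S_def)
    have "{x\<in>A \<union> B. g x = i} = A" "{x\<in>A \<union> B. g x = j} = B"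
      using gA gB ij(2) by auto
    then have "\<forall>l\<in>{i, j}. card {x\<in>A \<union> B. g x = l} = k l"
      using AB by simp
    moreover have "{1..2::nat} = {i, j}"
      unfolding ij(1) by auto
    moreover have "A \<union> B \<subseteq> kept k L g d xs"
      using AB(1,2) SS Gr_kept[of "{1, 2}"] Gr_kept[OF i] by blast
    ultimately show thesis
      using goal[OF _ AB(5)] by simp
  qed
  show thesis
  proof (cases "card (S 1) \<le> k 1")
    case True
    then show ?thesis using *[of 1 2] by simp
  next
    case False
    then show ?thesis using *[of 2 1] card_S by (simp add: insert_commute)
  qed
qed

section \<open>The streaming algorithm, its memory and its answer\<close>

lemma le_diversity_iff:
  "r \<le> diversity d S \<longleftrightarrow> pairwise (\<lambda>x y. r \<le> ereal (d x y)) S"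
  by (auto simp: diversity_def le_INF_iff pairwise_def)

text \<open>Both sides have the same lower bounds. Injectivity ensures that distinct indices stand
  for distinct points, so no zero distance enters the second infimum's counterpart.\<close>

lemma diversity_image:
  assumes "inj_on f I" "\<And>i j. i \<in> I \<Longrightarrow> j \<in> I \<Longrightarrow> D i j = d (f i) (f j)"
  shows "diversity D I = diversity d (f ` I)"
proof -
  have "r \<le> diversity D I \<longleftrightarrow> r \<le> diversity d (f ` I)" for r
    using assms by (fastforce simp: le_diversity_iff pairwise_def inj_on_def)
  then show ?thesis
    by (meson order.antisym order.refl)
qed

abbreviation pair_dist :: "('a \<Rightarrow> 'a \<Rightarrow> real) \<Rightarrow> 'a \<times> nat \<Rightarrow> 'a \<times> nat \<Rightarrow> real" where
  "pair_dist d p q \<equiv> d (fst p) (fst q)"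

definition fair_positions :: "(nat \<Rightarrow> nat) \<Rightarrow> nat list \<Rightarrow> nat set set" where
  "fair_positions k gs =
     {I. I \<subseteq> {..<length gs} \<and> (\<forall>i\<in>{1..2}. card {j\<in>I. gs ! j = i} = k i)}"

text \<open>\<open>retain\<close> recomputes every greedy set from the stored points and the
  arrival, and \<open>answer\<close> searches all fair sets of positions: space counts stored points
  only, so exhaustive search is allowed.\<close>

definition fair_alg :: "(nat \<Rightarrow> nat) \<Rightarrow> real set \<Rightarrow> stream_alg" where
  "fair_alg k L =
     \<lparr>retain = (\<lambda>(gs, D). kept k L ((!) gs) (\<lambda>i j. D ! i ! j) [0..<length gs]),
      answer = (\<lambda>(gs, D). arg_max (diversity (\<lambda>i j. D ! i ! j)) (\<lambda>I. I \<in> fair_positions k gs))\<rparr>"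

lemma view_nth:
  assumes "i < length ms" "j < length ms"
  shows "snd (view d ms) ! i ! j = pair_dist d (ms ! i) (ms ! j)"
  using assms by (simp add: view_def case_prod_beta)

lemma fst_view: "fst (view d ms) = map snd ms"
  by (simp add: view_def)

lemma set_nths_image: "I \<subseteq> {..<length xs} \<Longrightarrow> set (nths xs I) = (!) xs ` I"
  by (auto simp: set_nths)

text \<open>Reads \<open>retain\<close> in terms of points: \<open>image_kept\<close> along
  \<open>(!) ms\<close> carries the selected positions to the kept points.\<close>

lemma nths_retain:
  assumes "distinct ms"
  shows "nths ms (retain (fair_alg k L) (view d ms)) =
    filter (\<lambda>x. x \<in> kept k L snd (pair_dist d) ms) ms"
proof -
  let ?I = "retain (fair_alg k L) (view d ms)"
  have I: "?I = kept k L ((!) (map snd ms)) (\<lambda>i j. snd (view d ms) ! i ! j) [0..<length ms]"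
    by (simp add: fair_alg_def case_prod_beta fst_view)
  have "?I \<subseteq> {..<length ms}"
    unfolding I using kept_subset by fastforce
  then have "set (nths ms ?I) = (!) ms ` ?I"
    by (rule set_nths_image)
  also have "\<dots> = kept k L snd (pair_dist d) (map ((!) ms) [0..<length ms])"
    unfolding I by (rule image_kept) (auto simp: view_nth)
  finally have "set (nths ms ?I) = kept k L snd (pair_dist d) ms"
    by (simp add: map_nth)
  then show ?thesis
    using filter_in_nths[OF assms, of ?I] by simp
qed

text \<open>The invariant of the pass: the memory agrees with what the greedy runs on the whole
  prefix would keep, although the algorithm reruns them on stored points only.\<close>

lemma stream_memory_fair_alg:
  assumes "distinct \<sigma>"
  shows "stream_memory (fair_alg k L) d \<sigma> = filter (\<lambda>x. x \<in> kept k L snd (pair_dist d) \<sigma>) \<sigma>"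
  using assms
proof (induction \<sigma> rule: rev_induct)
  case Nil
  then show ?case by (simp add: stream_memory_def)
next
  case (snoc x \<sigma>)
  let ?K = "kept k L snd (pair_dist d)"
  define ms where "ms = filter (\<lambda>y. y \<in> ?K \<sigma>) \<sigma> @ [x]"
  have ms: "ms = filter (\<lambda>y. y \<in> insert x (?K \<sigma>)) (\<sigma> @ [x])"
    using snoc.prems by (auto simp: ms_def intro!: filter_cong)
  \<comment> \<open>The list \<open>ms\<close> omits only points outside
    \<open>insert x (?K \<sigma>)\<close>, which the run on the longer prefix does not keep
    either.\<close>
  have K: "?K ms = ?K (\<sigma> @ [x])"
    unfolding ms by (rule kept_filter) (rule kept_snoc)
  have "stream_memory (fair_alg k L) d (\<sigma> @ [x]) = nths ms (retain (fair_alg k L) (view d ms))"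
    using snoc by (simp add: stream_memory_def stream_step_def ms_def)
  also have "\<dots> = filter (\<lambda>y. y \<in> ?K (\<sigma> @ [x])) ms"
    using snoc.prems by (subst nths_retain) (auto simp: K, simp add: ms_def)
  also have "\<dots> = filter (\<lambda>y. y \<in> ?K (\<sigma> @ [x])) (\<sigma> @ [x])"
    unfolding ms filter_filter using kept_snoc[of k L snd "pair_dist d" \<sigma> x]
    by (intro filter_cong) auto
  finally show ?case .
qed

lemma stream_space_fair_alg:
  assumes "distinct \<sigma>" "finite L" "2 * real (card L) * real (k 1 + k 2) \<le> B"
  shows "stream_space_le (fair_alg k L) d \<sigma> B"
  unfolding stream_space_le_def
proof (intro allI impI)
  fix t
  let ?ms = "stream_memory (fair_alg k L) d (take t \<sigma>)"
  have ms: "?ms = filter (\<lambda>x. x \<in> kept k L snd (pair_dist d) (take t \<sigma>)) (take t \<sigma>)"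
    using assms(1) by (intro stream_memory_fair_alg) simp
  have "length ?ms = card (set ?ms)"
    unfolding ms using assms(1) by (intro distinct_card[symmetric] distinct_filter) simp
  also have "\<dots> \<le> card (kept k L snd (pair_dist d) (take t \<sigma>))"
    unfolding ms by (intro card_mono finite_subset[OF kept_subset]) auto
  also have "\<dots> \<le> 2 * card L * (k 1 + k 2)"
    by (rule card_kept[OF assms(2)])
  finally have "real (length ?ms) \<le> real (2 * card L * (k 1 + k 2))"
    by (rule of_nat_mono)
  then show "real (length ?ms) \<le> B"
    using assms(3) by simp
qed

text \<open>The set \<open>T\<close> shows that the finite family of fair position sets is nonempty,
  so \<open>arg_max\<close> attains a true maximum, which is at least the value at the positions of
  \<open>T\<close>.\<close>

lemma answer_fair_alg:
  assumes inj: "inj_on fst (set ms)" and "distinct ms"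
    and T: "T \<subseteq> set ms" "\<forall>i\<in>{1..2}. card {p\<in>T. snd p = i} = k i"
  obtains R where "R \<subseteq> set ms" "set (nths ms (answer (fair_alg k L) (view d ms))) = R"
    "\<forall>i\<in>{1..2}. card {p\<in>R. snd p = i} = k i"
    "diversity d (fst ` T) \<le> diversity d (fst ` R)"
proof -
  define f where "f = diversity (\<lambda>i j. snd (view d ms) ! i ! j)"
  define F where "F = fair_positions k (map snd ms)"
  define I where "I = answer (fair_alg k L) (view d ms)"
  have I: "I = arg_max f (\<lambda>I. I \<in> F)"
    by (simp add: I_def fair_alg_def case_prod_beta fst_view f_def F_def)
  have inj_nth: "inj_on ((!) ms) J" if "J \<subseteq> {..<length ms}" for J
    using that \<open>distinct ms\<close> by (intro inj_on_nth) auto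
  have f: "f J = diversity d (fst ` (!) ms ` J)" if J: "J \<subseteq> {..<length ms}" for J
  proof -
    have "(!) ms ` J \<subseteq> set ms" using J by auto
    then have "inj_on (\<lambda>i. fst (ms ! i)) J"
      using comp_inj_on[OF inj_nth[OF J] inj_on_subset[OF inj]] by (simp add: comp_def)
    then have "f J = diversity d ((\<lambda>i. fst (ms ! i)) ` J)"
      unfolding f_def using J by (intro diversity_image) (auto simp: view_nth subset_iff)
    then show ?thesis by (simp add: image_image)
  qed
  have count: "card {p\<in>(!) ms ` J. snd p = i} = card {j\<in>J. map snd ms ! j = i}"
    if J: "J \<subseteq> {..<length ms}" for J i
  proof -
    have "{p\<in>(!) ms ` J. snd p = i} = (!) ms ` {j\<in>J. map snd ms ! j = i}"
      using J by (auto simp: subset_iff)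
    then show ?thesis
      using J by (simp add: card_image inj_nth subset_iff)
  qed
  define J where "J = {j. j < length ms \<and> ms ! j \<in> T}"
  have J: "J \<subseteq> {..<length ms}" by (auto simp: J_def)
  have T_eq: "T = (!) ms ` J"
  proof (intro equalityI subsetI)
    fix p assume "p \<in> T"
    moreover from this obtain i where "i < length ms" "ms ! i = p"
      using T(1) by (meson in_set_conv_nth subsetD)
    ultimately show "p \<in> (!) ms ` J" by (auto simp: J_def)
  qed (auto simp: J_def)
  have JF: "J \<in> F"
    using T(2) J count[OF J] by (simp add: F_def fair_positions_def T_eq)
  have "finite F"
    by (rule finite_subset[of _ "Pow {..<length ms}"]) (auto simp: F_def fair_positions_def)
  then have "Max (f ` F) \<in> f ` F"
    using JF by (intro Max_in) auto
  then obtain I0 where I0: "I0 \<in> F" "f I0 = Max (f ` F)"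
    by auto
  have le: "f I' \<le> f I0" if "I' \<in> F" for I'
    using that \<open>finite F\<close> I0(2) by simp
  have best: "I \<in> F \<and> f J \<le> f I"
    unfolding I
  proof (rule arg_maxI[of "\<lambda>I. I \<in> F" I0 f])
    fix I' assume "I' \<in> F" "\<forall>I''. I'' \<in> F \<longrightarrow> \<not> f I' < f I''"
    then show "I' \<in> F \<and> f J \<le> f I'" using JF not_less by blast
  qed (use I0(1) le in \<open>auto simp: not_less\<close>)
  then have sub: "I \<subseteq> {..<length ms}"
    by (auto simp: F_def fair_positions_def)
  show thesis
  proof
    show "set (nths ms (answer (fair_alg k L) (view d ms))) = (!) ms ` I"
      using set_nths_image[OF sub] by (simp add: I_def)
    show "(!) ms ` I \<subseteq> set ms" using sub by auto
    show "\<forall>i\<in>{1..2}. card {p\<in>(!) ms ` I. snd p = i} = k i"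
      using best count[OF sub] by (simp add: F_def fair_positions_def)
    show "diversity d (fst ` T) \<le> diversity d (fst ` (!) ms ` I)"
      using best f[OF J] f[OF sub] T_eq by simp
  qed
qed

section \<open>The grid of guesses and its size\<close>

lemma poly_le_monomial:
  fixes p :: "real poly"
  assumes "1 \<le> x"
  shows "poly p x \<le> (\<Sum>i\<le>degree p. \<bar>coeff p i\<bar>) * x ^ degree p"
proof -
  have "poly p x \<le> (\<Sum>i\<le>degree p. \<bar>coeff p i\<bar> * x ^ degree p)"
    unfolding poly_altdef using assms
    by (intro sum_mono mult_mono power_increasing) auto
  then show ?thesis by (simp add: sum_distrib_right)
qed

text \<open>Turns a ratio polynomial in \<open>n\<close> into a logarithmic bound whose constant
  depends on \<open>p\<close> alone.\<close>

lemma ln_le_log_of_poly_bound: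
  fixes p :: "real poly"
  obtains c where "0 \<le> c"
    "\<And>n y. \<lbrakk>2 \<le> n; 1 \<le> y; y \<le> poly p (real n)\<rbrakk> \<Longrightarrow> ln y \<le> c * log 2 (real n)"
proof
  \<comment> \<open>The summand \<open>1\<close> makes \<open>ln a\<close> nonnegative, also when
    \<open>p\<close> is zero.\<close>
  define a where "a = 1 + (\<Sum>i\<le>degree p. \<bar>coeff p i\<bar>)"
  have a: "1 \<le> a" by (simp add: a_def sum_nonneg)
  show "0 \<le> ln a + real (degree p)" using a by simp
  fix n :: nat and y :: real
  assume n: "2 \<le> n" and y: "1 \<le> y" "y \<le> poly p (real n)"
  note y(2)
  also have "poly p (real n) \<le> (\<Sum>i\<le>degree p. \<bar>coeff p i\<bar>) * real n ^ degree p"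
    using n by (intro poly_le_monomial) simp
  also have "\<dots> \<le> a * real n ^ degree p"
    by (intro mult_right_mono) (auto simp: a_def)
  finally have "ln y \<le> ln (a * real n ^ degree p)"
    using y a n by (subst ln_le_cancel_iff) auto
  also have "\<dots> = ln a + degree p * ln n"
    using a n by (simp add: ln_mult ln_realpow)
  \<comment> \<open>Since \<open>n \<ge> 2\<close>, \<open>log 2 n \<ge> 1\<close> absorbs the
    constant term.\<close>
  also have "\<dots> \<le> ln a * log 2 n + degree p * log 2 n"
  proof (intro add_mono mult_left_mono)
    have log1: "1 \<le> log 2 (real n)" using n by simp
    then show "ln a \<le> ln a * log 2 n"
      using a by (intro mult_le_cancel_left1[THEN iffD2]) auto
    have "ln (2::real) \<le> 1" using ln_2_less_1 by simp
    then show "ln (real n) \<le> log 2 n"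
      using n unfolding log_def by (simp add: field_simps mult_left_le)
  qed auto
  finally show "ln y \<le> (ln a + real (degree p)) * log 2 (real n)"
    by (simp add: algebra_simps)
qed

text \<open>Source of the factor \<open>1 / \<epsilon>\<close> in the space bound: a logarithm to
  base \<open>1 + \<epsilon>\<close> costs at most \<open>2 / \<epsilon>\<close> times the natural
  one.\<close>

lemma half_le_ln_one_plus:
  assumes "0 < e" "e < (1::real)"
  shows "e / 2 \<le> ln (1 + e)"
proof -
  have "exp (e / 2) \<le> 1 + e / 2 + (e / 2)\<^sup>2"
    using assms by (intro exp_bound) auto
  also have "\<dots> \<le> 1 + e"
    using assms mult_left_le[of e e] by (simp add: power2_eq_square field_simps)
  finally show ?thesis
    using assms by (subst ln_ge_iff) auto
qed

text \<open>The guesses are for half of the optimum, hence the start at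
  \<open>lo / 2\<close>.\<close>

definition thresholds :: "real \<Rightarrow> real \<Rightarrow> real \<Rightarrow> real set" where
  "thresholds \<epsilon> lo hi = (\<lambda>j. lo / 2 * (1 + \<epsilon>) ^ j) ` {..nat \<lfloor>log (1 + \<epsilon>) (hi / lo)\<rfloor>}"

lemma finite_thresholds: "finite (thresholds \<epsilon> lo hi)"
  by (simp add: thresholds_def)

lemma thresholds_pos: "0 < \<epsilon> \<Longrightarrow> 0 < lo \<Longrightarrow> \<mu> \<in> thresholds \<epsilon> lo hi \<Longrightarrow> 0 < \<mu>"
  by (auto simp: thresholds_def)

lemma card_thresholds_le:
  assumes "0 < \<epsilon>" "\<epsilon> < 1" "1 \<le> hi / lo"
  shows "real (card (thresholds \<epsilon> lo hi)) \<le> 1 + 2 * ln (hi / lo) / \<epsilon>"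
proof -
  have "card (thresholds \<epsilon> lo hi) \<le> Suc (nat \<lfloor>log (1 + \<epsilon>) (hi / lo)\<rfloor>)"
    unfolding thresholds_def by (rule order.trans[OF card_image_le]) auto
  moreover have "0 \<le> log (1 + \<epsilon>) (hi / lo)"
    using assms by simp
  then have "real (nat \<lfloor>log (1 + \<epsilon>) (hi / lo)\<rfloor>) \<le> log (1 + \<epsilon>) (hi / lo)"
    by linarith
  moreover have "log (1 + \<epsilon>) (hi / lo) \<le> ln (hi / lo) / (\<epsilon> / 2)"
    unfolding log_def using assms half_le_ln_one_plus[of \<epsilon>] by (intro divide_left_mono) auto
  ultimately show ?thesis by (simp add: mult.commute)
qed

lemma threshold_near:
  assumes "0 < \<epsilon>" "0 < lo" "lo \<le> l" "l \<le> hi"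
  obtains \<mu> where "\<mu> \<in> thresholds \<epsilon> lo hi" "2 * \<mu> \<le> l" "l \<le> 2 * (1 + \<epsilon>) * \<mu>"
proof
  \<comment> \<open>The largest exponent with \<open>lo * (1 + \<epsilon>) ^ j \<le> l\<close>; its
    maximality gives the upper bound on \<open>l\<close>.\<close>
  define j where "j = nat \<lfloor>log (1 + \<epsilon>) (l / lo)\<rfloor>"
  have nonneg: "0 \<le> log (1 + \<epsilon>) (l / lo)"
    using assms by simp
  then have j: "real j \<le> log (1 + \<epsilon>) (l / lo)" "log (1 + \<epsilon>) (l / lo) < real (Suc j)"
    unfolding j_def by linarith+
  have "log (1 + \<epsilon>) (l / lo) \<le> log (1 + \<epsilon>) (hi / lo)"
    using assms by (simp add: divide_right_mono)
  then have "j \<le> nat \<lfloor>log (1 + \<epsilon>) (hi / lo)\<rfloor>"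
    unfolding j_def by (intro nat_mono floor_mono)
  then show "lo / 2 * (1 + \<epsilon>) ^ j \<in> thresholds \<epsilon> lo hi"
    by (auto simp: thresholds_def)
  have "(1 + \<epsilon>) powr real j \<le> l / lo" "l / lo < (1 + \<epsilon>) powr real (Suc j)"
    using j assms by (simp_all add: le_log_iff log_less_iff del: of_nat_Suc)
  then have "(1 + \<epsilon>) ^ j \<le> l / lo" "l / lo < (1 + \<epsilon>) ^ Suc j"
    using assms by (simp_all add: powr_realpow del: of_nat_Suc power_Suc)
  then show "2 * (lo / 2 * (1 + \<epsilon>) ^ j) \<le> l" "l \<le> 2 * (1 + \<epsilon>) * (lo / 2 * (1 + \<epsilon>) ^ j)"
    using assms by (simp_all add: field_simps)
qed


section \<open>Fair sets as sets of stream entries, and the optimum\<close>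

lemma group_unique:
  assumes "fair_instance m X d G k" "x \<in> G i" "x \<in> G j" "i \<in> {1..m}" "j \<in> {1..m}"
  shows "i = j"
  using assms disjoint_family_onD[of G "{1..m}" i j] unfolding fair_instance_def by blast

text \<open>Disjointness of the groups lets a point determine its stream entry, so points and
  entries can be identified.\<close>

lemma stream_inj_on:
  assumes "fair_instance 2 X d G k" "stream_of 2 G \<sigma>"
  shows "inj_on fst (set \<sigma>)"
proof (rule inj_onI)
  fix p q assume pq: "p \<in> set \<sigma>" "q \<in> set \<sigma>" "fst p = fst q"
  have "set \<sigma> = {(x, i). i \<in> {1..2} \<and> x \<in> G i}"
    using assms(2) by (simp only: stream_of_def)
  with pq show "p = q"
    using group_unique[OF assms(1), of "fst p" "snd p" "snd q"] by (auto simp: prod_eq_iff)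
qed

lemma fst_image_fair_sets:
  assumes "fair_instance 2 X d G k" "stream_of 2 G \<sigma>" "R \<subseteq> set \<sigma>"
  shows "fst ` R \<in> fair_sets 2 X G k \<longleftrightarrow> (\<forall>i\<in>{1..2}. card {p\<in>R. snd p = i} = k i)"
proof -
  have set: "set \<sigma> = {(x, i). i \<in> {1..2} \<and> x \<in> G i}" and X: "X = (\<Union>i\<in>{1..2}. G i)"
    using assms(1,2) unfolding fair_instance_def stream_of_def by blast+
  have "card (fst ` R \<inter> G i) = card {p\<in>R. snd p = i}" if i: "i \<in> {1..2}" for i
  proof -
    have "fst ` R \<inter> G i = fst ` {p\<in>R. snd p = i}"
    proof (intro equalityI subsetI)
      fix x assume "x \<in> fst ` R \<inter> G i"
      then obtain p where p: "p \<in> R" "x = fst p" "x \<in> G i" by blast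
      then have "snd p = i"
        using assms(3) i group_unique[OF assms(1), of x "snd p" i] unfolding set by auto
      with p show "x \<in> fst ` {p\<in>R. snd p = i}" by blast
    qed (use assms(3) set in auto)
    moreover have "inj_on fst {p\<in>R. snd p = i}"
      using assms(3) by (intro inj_on_subset[OF stream_inj_on[OF assms(1,2)]]) auto
    ultimately show ?thesis by (simp add: card_image)
  qed
  moreover have "fst ` R \<subseteq> X"
    using assms(3) unfolding set X by fastforce
  ultimately show ?thesis
    by (simp add: fair_sets_def)
qed

lemma fair_set_in_stream:
  assumes "fair_instance 2 X d G k" "stream_of 2 G \<sigma>" "S \<in> fair_sets 2 X G k"
  obtains R where "R \<subseteq> set \<sigma>" "S = fst ` R" "\<forall>i\<in>{1..2}. card {p\<in>R. snd p = i} = k i"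
proof
  let ?R = "{p\<in>set \<sigma>. fst p \<in> S}"
  have "S \<subseteq> fst ` set \<sigma>"
  proof
    fix x assume "x \<in> S"
    then obtain i where "i \<in> {1..2}" "x \<in> G i"
      using assms(1,3) unfolding fair_instance_def fair_sets_def by blast
    then have "(x, i) \<in> set \<sigma>"
      using assms(2) unfolding stream_of_def by simp
    then show "x \<in> fst ` set \<sigma>" by force
  qed
  then show S: "S = fst ` ?R" by auto
  show sub: "?R \<subseteq> set \<sigma>" by blast
  show "\<forall>i\<in>{1..2}. card {p\<in>?R. snd p = i} = k i"
    using fst_image_fair_sets[OF assms(1,2) sub] assms(3) S by simp
qed

text \<open>The maximum ranges over a finite family. It is nonempty: choose \<open>k i\<close>
  points in each group; by disjointness their union meets each group in just the chosen
  points.\<close>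

lemma opt_diversity_attained:
  assumes "fair_instance m X d G k"
  obtains S where "S \<in> fair_sets m X G k" "opt_diversity m X d G k = diversity d S"
proof -
  have fin: "finite X" and X: "X = (\<Union>i\<in>{1..m}. G i)"
    and k: "\<forall>i\<in>{1..m}. k i \<le> card (G i)"
    using assms unfolding fair_instance_def by blast+
  have "\<exists>T. \<forall>i\<in>{1..m}. T i \<subseteq> G i \<and> card (T i) = k i"
    using k by (intro bchoice) (meson obtain_subset_with_card_n)
  then obtain T where T: "\<forall>i\<in>{1..m}. T i \<subseteq> G i \<and> card (T i) = k i" by blast
  have "(\<Union>j\<in>{1..m}. T j) \<inter> G i = T i" if "i \<in> {1..m}" for i
  proof (intro equalityI subsetI)
    fix x assume "x \<in> (\<Union>j\<in>{1..m}. T j) \<inter> G i"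
    then obtain j where j: "j \<in> {1..m}" "x \<in> T j" "x \<in> G i" by blast
    with T have "x \<in> G j" by blast
    with j that show "x \<in> T i"
      using group_unique[OF assms] by metis
  qed (use T that in blast)
  then have "(\<Union>j\<in>{1..m}. T j) \<in> fair_sets m X G k"
    using T unfolding fair_sets_def X by fastforce
  moreover have "finite (fair_sets m X G k)"
    by (rule finite_subset[of _ "Pow X"]) (auto simp: fair_sets_def fin)
  ultimately have "opt_diversity m X d G k \<in> diversity d ` fair_sets m X G k"
    unfolding opt_diversity_def by (intro Max_in) auto
  then show thesis using that by blast
qed

lemma diversity_finite_attained:
  assumes "finite S" "x \<in> S" "y \<in> S" "x \<noteq> y"
  obtains u v where "u \<in> S" "v \<in> S" "u \<noteq> v" "diversity d S = ereal (d u v)"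
proof -
  let ?P = "{(u, v). u \<in> S \<and> v \<in> S \<and> u \<noteq> v}"
  let ?f = "\<lambda>(u, v). ereal (d u v)"
  have P: "finite (?f ` ?P)" "?f ` ?P \<noteq> {}"
    using assms by (auto intro!: finite_imageI intro: finite_subset[of _ "S \<times> S"])
  have "diversity d S = Min (?f ` ?P)"
    unfolding diversity_def using P by (rule Min_Inf[symmetric])
  also have "\<dots> \<in> ?f ` ?P" using P by (rule Min_in)
  finally show thesis using that by auto
qed

section \<open>The approximation guarantee\<close>

text \<open>One suitable guess in \<open>L\<close> suffices, and it need not be identified, because
  the answer is optimal over the whole memory.\<close>

lemma stream_result_fair_alg:
  assumes inst: "fair_instance 2 X d G k" "stream_of 2 G \<sigma>"
    and L: "\<mu> \<in> L" "0 < \<mu>"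
    and S: "S \<in> fair_sets 2 X G k" "pairwise (\<lambda>x y. 2 * \<mu> \<le> d x y) S"
  shows "stream_result (fair_alg k L) d \<sigma> \<in> fair_sets 2 X G k"
    and "ereal (\<mu> / 2) \<le> diversity d (stream_result (fair_alg k L) d \<sigma>)"
proof -
  let ?K = "kept k L snd (pair_dist d) \<sigma>"
  define ms where "ms = filter (\<lambda>x. x \<in> ?K) \<sigma>"
  have dist: "distinct \<sigma>" and set: "set \<sigma> = {(x, i). i \<in> {1..2} \<and> x \<in> G i}"
    and X: "X = (\<Union>i\<in>{1..2}. G i)"
    using inst unfolding stream_of_def fair_instance_def by blast+
  have mem: "stream_memory (fair_alg k L) d \<sigma> = ms"
    unfolding ms_def by (rule stream_memory_fair_alg[OF dist])
  have set_ms: "set ms = ?K"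
    using kept_subset[of k L snd "pair_dist d" \<sigma>] by (auto simp: ms_def)
  note inj = stream_inj_on[OF inst]
  have "Metric_space X d"
    using inst(1) unfolding fair_instance_def by blast
  moreover have "fst p \<in> X" if "p \<in> set \<sigma>" for p
    using that unfolding set X by auto
  \<comment> \<open>Injectivity of \<open>fst\<close> on the stream ensures that only equal entries
    have distance zero.\<close>
  ultimately have metric: "Metric_space (set \<sigma>) (pair_dist d)"
    using inj unfolding Metric_space_def inj_on_def by metis
  obtain Opt where Opt: "Opt \<subseteq> set \<sigma>" "S = fst ` Opt" "\<forall>i\<in>{1..2}. card {p\<in>Opt. snd p = i} = k i"
    using fair_set_in_stream[OF inst S(1)] by blast
  have sep: "pairwise (\<lambda>p q. 2 * \<mu> \<le> pair_dist d p q) Opt"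
    using S(2) Opt(1,2) inj unfolding pairwise_def inj_on_def by blast
  have groups: "snd ` set \<sigma> \<subseteq> {1, 2}"
    unfolding set by auto
  obtain T where T: "T \<subseteq> ?K" "pairwise (\<lambda>p q. \<mu> / 2 \<le> pair_dist d p q) T"
    "\<forall>i\<in>{1..2}. card {p\<in>T. snd p = i} = k i"
    using Metric_space.kept_contains_fair[OF metric subset_refl dist groups L Opt(1) sep Opt(3)]
    by blast
  have inj_ms: "inj_on fst (set ms)"
    by (rule inj_on_subset[OF inj]) (auto simp: ms_def)
  have dist_ms: "distinct ms"
    using dist by (simp add: ms_def)
  obtain R where R: "R \<subseteq> set ms" "set (nths ms (answer (fair_alg k L) (view d ms))) = R"
    "\<forall>i\<in>{1..2}. card {p\<in>R. snd p = i} = k i" "diversity d (fst ` T) \<le> diversity d (fst ` R)"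
    using answer_fair_alg[OF inj_ms dist_ms T(1)[folded set_ms] T(3)] by blast
  have res: "stream_result (fair_alg k L) d \<sigma> = fst ` R"
    unfolding stream_result_def mem Let_def R(2) ..
  have "R \<subseteq> set \<sigma>"
    using R(1) by (auto simp: ms_def)
  then show "stream_result (fair_alg k L) d \<sigma> \<in> fair_sets 2 X G k"
    unfolding res using fst_image_fair_sets[OF inst] R(3) by blast
  have "ereal (\<mu> / 2) \<le> diversity d (fst ` T)"
    using T(2) unfolding le_diversity_iff pairwise_def by auto
  then show "ereal (\<mu> / 2) \<le> diversity d (stream_result (fair_alg k L) d \<sigma>)"
    unfolding res using R(4) by (rule order.trans)
qed

text \<open>All fair sets thus have equal size, which settles the case of an infinite
  optimum.\<close>

lemma card_fair_set:
  assumes "fair_instance 2 X d G k" "S \<in> fair_sets 2 X G k"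
  shows "finite S" "card S = k 1 + k 2"
proof -
  have two: "{1..2::nat} = {1, 2}" by auto
  have fin: "finite X" and X: "X = G 1 \<union> G 2"
    using assms(1) unfolding fair_instance_def two by auto
  have S: "S \<subseteq> X" "card (S \<inter> G 1) = k 1" "card (S \<inter> G 2) = k 2"
    using assms(2) unfolding fair_sets_def two by auto
  have disj: "G 1 \<inter> G 2 = {}"
    using group_unique[OF assms(1), of _ 1 2] by auto
  show finS: "finite S" using S(1) fin finite_subset by blast
  have "card S = card ((S \<inter> G 1) \<union> (S \<inter> G 2))"
    using S(1) X by (intro arg_cong[of _ _ card]) blast
  also have "\<dots> = k 1 + k 2"
    using finS disj S by (subst card_Un_disjoint) auto
  finally show "card S = k 1 + k 2" .
qed

text \<open>The factor \<open>4 * (1 + \<epsilon>)\<close> is a product: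
  \<open>1 + \<epsilon>\<close> from rounding to the grid, \<open>2\<close> from requiring
  \<open>2 * \<mu>\<close> to be at most the optimum, and \<open>2\<close> from the
  exchange.\<close>

lemma fair_alg_approximation:
  assumes inst: "fair_instance 2 X d G k" "stream_of 2 G \<sigma>"
    and \<epsilon>: "0 < \<epsilon>" and lo: "0 < lo" "lo \<le> hi"
    and bounds: "\<forall>u\<in>X. \<forall>v\<in>X. u \<noteq> v \<longrightarrow> lo \<le> d u v \<and> d u v \<le> hi"
  defines "R \<equiv> stream_result (fair_alg k (thresholds \<epsilon> lo hi)) d \<sigma>"
  shows "R \<in> fair_sets 2 X G k \<and> opt_diversity 2 X d G k / ereal (4 * (1 + \<epsilon>)) \<le> diversity d R"
proof -
  obtain S where S: "S \<in> fair_sets 2 X G k" "opt_diversity 2 X d G k = diversity d S"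
    using opt_diversity_attained[OF inst(1)] by blast
  have SX: "S \<subseteq> X" using S(1) by (simp add: fair_sets_def)
  show ?thesis
  proof (cases "\<exists>x y. x \<in> S \<and> y \<in> S \<and> x \<noteq> y")
    case True
    then obtain u v where uv: "u \<in> S" "v \<in> S" "u \<noteq> v" "diversity d S = ereal (d u v)"
      using diversity_finite_attained[OF card_fair_set(1)[OF inst(1) S(1)]] by blast
    obtain \<mu> where \<mu>: "\<mu> \<in> thresholds \<epsilon> lo hi" "2 * \<mu> \<le> d u v" "d u v \<le> 2 * (1 + \<epsilon>) * \<mu>"
      using threshold_near[OF \<epsilon> lo(1), of "d u v" hi] bounds uv SX by blast
    have "pairwise (\<lambda>x y. ereal (d u v) \<le> ereal (d x y)) S"
      unfolding le_diversity_iff[symmetric] uv(4) ..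
    then have sep: "pairwise (\<lambda>x y. 2 * \<mu> \<le> d x y) S"
      using \<mu>(2) by (auto simp: pairwise_def intro: order.trans)
    note res = stream_result_fair_alg[OF inst \<mu>(1) thresholds_pos[OF \<epsilon> lo(1) \<mu>(1)] S(1) sep]
    have "opt_diversity 2 X d G k / ereal (4 * (1 + \<epsilon>)) = ereal (d u v / (4 * (1 + \<epsilon>)))"
      using \<epsilon> by (simp add: S(2) uv(4))
    also have "\<dots> \<le> ereal (\<mu> / 2)"
      using \<mu>(3) \<epsilon> by (simp add: field_simps)
    finally show ?thesis
      using res unfolding R_def by (blast intro: order.trans)
  next
    case False
    \<comment> \<open>Here the optimum is \<open>\<infinity>\<close>, so the answer must have at most one point; any guess will do.\<close>
    obtain \<mu> where \<mu>: "\<mu> \<in> thresholds \<epsilon> lo hi"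
      using threshold_near[OF \<epsilon> lo(1) order_refl lo(2)] by blast
    have sep: "pairwise (\<lambda>x y. 2 * \<mu> \<le> d x y) S"
      using False by (auto simp: pairwise_def)
    note res = stream_result_fair_alg[OF inst \<mu> thresholds_pos[OF \<epsilon> lo(1) \<mu>] S(1) sep]
    have "card S \<le> 1"
      using False card_fair_set(1)[OF inst(1) S(1)] by (metis card_le_Suc0_iff_eq One_nat_def)
    then have "card R \<le> Suc 0" and "finite R"
      using card_fair_set[OF inst(1) S(1)] card_fair_set[OF inst(1) res(1)] by (auto simp: R_def)
    then have "\<forall>x\<in>R. \<forall>y\<in>R. x = y"
      using card_le_Suc0_iff_eq by blast
    then have "\<infinity> \<le> diversity d R"
      unfolding le_diversity_iff by (auto simp: pairwise_def)
    then show ?thesis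
      using res(1) unfolding R_def by simp
  qed
qed

theorem theorem8:
  "\<exists>A :: real \<Rightarrow> (nat \<Rightarrow> nat) \<Rightarrow> real \<Rightarrow> real \<Rightarrow> stream_alg.
     \<forall>p :: real poly. \<exists>C :: real.
       \<forall>(\<epsilon> :: real) (X :: 'a set) (d :: 'a \<Rightarrow> 'a \<Rightarrow> real) (G :: nat \<Rightarrow> 'a set) (k :: nat \<Rightarrow> nat)
         (n :: nat) (lo :: real) (hi :: real) (\<sigma> :: ('a \<times> nat) list).
         0 < \<epsilon> \<longrightarrow> \<epsilon> < 1 \<longrightarrow>
         fair_instance 2 X d G k \<longrightarrow> card X = n \<longrightarrow> n \<ge> 2 \<longrightarrow>
         0 < lo \<longrightarrow> (\<forall>u\<in>X. \<forall>v\<in>X. u \<noteq> v \<longrightarrow> lo \<le> d u v \<and> d u v \<le> hi) \<longrightarrow>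
         hi / lo \<le> poly p (real n) \<longrightarrow>
         stream_of 2 G \<sigma> \<longrightarrow>
         stream_result (A \<epsilon> k lo hi) d \<sigma> \<in> fair_sets 2 X G k \<and>
         diversity d (stream_result (A \<epsilon> k lo hi) d \<sigma>)
           \<ge> opt_diversity 2 X d G k / ereal (4 * (1 + \<epsilon>)) \<and>
         stream_space_le (A \<epsilon> k lo hi) d \<sigma>
           (C * real (k 1 + k 2) * (1 / \<epsilon>) * log 2 (real n))"
\<comment> \<open>The algorithm is fixed before \<open>p\<close>; only the constant depends on the
  polynomial.\<close>
proof (rule exI[of _ "\<lambda>\<epsilon> k lo hi. fair_alg k (thresholds \<epsilon> lo hi)"], rule allI)
  fix p :: "real poly"
  obtain c where c: "0 \<le> c"
    "\<And>n y. \<lbrakk>2 \<le> n; 1 \<le> y; y \<le> poly p (real n)\<rbrakk> \<Longrightarrow> ln y \<le> c * log 2 (real n)"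
    using ln_le_log_of_poly_bound by blast
  show "\<exists>C :: real.
       \<forall>(\<epsilon> :: real) (X :: 'a set) (d :: 'a \<Rightarrow> 'a \<Rightarrow> real) (G :: nat \<Rightarrow> 'a set) (k :: nat \<Rightarrow> nat)
         (n :: nat) (lo :: real) (hi :: real) (\<sigma> :: ('a \<times> nat) list).
         0 < \<epsilon> \<longrightarrow> \<epsilon> < 1 \<longrightarrow>
         fair_instance 2 X d G k \<longrightarrow> card X = n \<longrightarrow> n \<ge> 2 \<longrightarrow>
         0 < lo \<longrightarrow> (\<forall>u\<in>X. \<forall>v\<in>X. u \<noteq> v \<longrightarrow> lo \<le> d u v \<and> d u v \<le> hi) \<longrightarrow>
         hi / lo \<le> poly p (real n) \<longrightarrow>
         stream_of 2 G \<sigma> \<longrightarrow>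
         stream_result (fair_alg k (thresholds \<epsilon> lo hi)) d \<sigma> \<in> fair_sets 2 X G k \<and>
         diversity d (stream_result (fair_alg k (thresholds \<epsilon> lo hi)) d \<sigma>)
           \<ge> opt_diversity 2 X d G k / ereal (4 * (1 + \<epsilon>)) \<and>
         stream_space_le (fair_alg k (thresholds \<epsilon> lo hi)) d \<sigma>
           (C * real (k 1 + k 2) * (1 / \<epsilon>) * log 2 (real n))"
  \<comment> \<open>The outer \<open>2\<close> comes from \<open>card_kept\<close>, and
    \<open>1 + 2 * c\<close> from the number of guesses.\<close>
  proof (intro exI[of _ "2 * (1 + 2 * c)"] allI impI)
    fix \<epsilon> :: real and X :: "'a set" and d :: "'a \<Rightarrow> 'a \<Rightarrow> real" and G :: "nat \<Rightarrow> 'a set"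
      and k :: "nat \<Rightarrow> nat" and n :: nat and lo hi :: real and \<sigma> :: "('a \<times> nat) list"
    assume \<epsilon>: "0 < \<epsilon>" "\<epsilon> < 1" and inst: "fair_instance 2 X d G k" and n: "card X = n" "n \<ge> 2"
      and lo: "0 < lo" and bounds: "\<forall>u\<in>X. \<forall>v\<in>X. u \<noteq> v \<longrightarrow> lo \<le> d u v \<and> d u v \<le> hi"
      and ratio: "hi / lo \<le> poly p (real n)" and \<sigma>: "stream_of 2 G \<sigma>"
    \<comment> \<open>Two distinct points are needed to get \<open>lo \<le> hi\<close> from the
      distance bounds.\<close>
    have "\<not> card X \<le> Suc 0" "finite X"
      using n inst by (auto simp: fair_instance_def)
    then obtain u v where "u \<in> X" "v \<in> X" "u \<noteq> v"
      using card_le_Suc0_iff_eq by blast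
    then have "lo \<le> hi"
      using bounds by force
    then have one: "1 \<le> hi / lo"
      using lo by simp
    have log1: "1 \<le> log 2 (real n)"
      using n(2) by simp
    let ?c = "card (thresholds \<epsilon> lo hi)"
    have "real ?c \<le> 1 + 2 * ln (hi / lo) / \<epsilon>"
      by (rule card_thresholds_le[OF \<epsilon> one])
    also have "\<dots> \<le> 1 / \<epsilon> * log 2 (real n) + 2 * (c * log 2 (real n)) / \<epsilon>"
    proof (intro add_mono divide_right_mono mult_left_mono)
      show "1 \<le> 1 / \<epsilon> * log 2 (real n)"
        using \<epsilon> log1 by (simp add: field_simps)
      show "ln (hi / lo) \<le> c * log 2 (real n)"
        using c(2)[OF n(2) one ratio] .
    qed (use \<epsilon> in auto)
    also have "\<dots> = (1 + 2 * c) * (1 / \<epsilon>) * log 2 (real n)"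
      by (simp add: algebra_simps add_divide_distrib)
    finally have "2 * real ?c * real (k 1 + k 2) \<le>
        2 * ((1 + 2 * c) * (1 / \<epsilon>) * log 2 (real n)) * real (k 1 + k 2)"
      by (intro mult_right_mono mult_left_mono) auto
    also have "\<dots> = 2 * (1 + 2 * c) * real (k 1 + k 2) * (1 / \<epsilon>) * log 2 (real n)"
      by (simp only: mult_ac)
    finally have "stream_space_le (fair_alg k (thresholds \<epsilon> lo hi)) d \<sigma>
        (2 * (1 + 2 * c) * real (k 1 + k 2) * (1 / \<epsilon>) * log 2 (real n))"
      using \<sigma> by (intro stream_space_fair_alg finite_thresholds) (auto simp: stream_of_def)
    then show "stream_result (fair_alg k (thresholds \<epsilon> lo hi)) d \<sigma> \<in> fair_sets 2 X G k \<and>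
         diversity d (stream_result (fair_alg k (thresholds \<epsilon> lo hi)) d \<sigma>)
           \<ge> opt_diversity 2 X d G k / ereal (4 * (1 + \<epsilon>)) \<and>
         stream_space_le (fair_alg k (thresholds \<epsilon> lo hi)) d \<sigma>
           (2 * (1 + 2 * c) * real (k 1 + k 2) * (1 / \<epsilon>) * log 2 (real n))"
      using fair_alg_approximation[OF inst \<sigma> \<epsilon>(1) lo \<open>lo \<le> hi\<close> bounds] by blast
  qed
qed

end
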